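(* For every metrizable space $X$ the following conditions are equivalent: (1) for every metric space $Y$ with more than one point, $vet(Q_p(X,Y))=\omega$; (2) there are a metric space $Y$ with more than one point and a function $f\in Q_p(X,Y)$ such that $vet(f,Q_p(X,Y))=\omega$; (3) there is a function $f\in Q_p(X,\mathbb{R})$ such that $vet(f,Q_p(X,\mathbb{R}))=\omega$; (4) $X$ satisfies $S_{\mathrm{fin}}(\mathcal{K}_\Omega,\mathcal{K}_\Omega)$.
   Context: A function $f:X\to Y$ between topological spaces is quasicontinuous if for every $x\in X$, every open $V\ni f(x)$ and every open $U\ni x$ there is a nonempty open $W\subseteq U$ with $f(W)\subseteq V$. $Q(X,Y)$ is the set of all quasicontinuous functions $X\to Y$, and $Q_p(X,Y)$ is $Q(X,Y)$ with the topology of pointwise convergence (the subspace topology from the product $Y^X$). A space $Z$ has countable fan-tightness at a point $z\in Z$, written $vet(z,Z)=\omega$, if for every sequence $(A_n)_{n\in\omega}$ of subsets of $Z$ with $z\in\bigcap_{n\in\omega}\overline{A_n}$ there are finite sets $K_n\subseteq A_n$ such that $z\in\overline{\bigcup_{n\in\omega}K_n}$. $Z$ has countable fan-tightness, written $vet(Z)=\omega$, if $vet(z,Z)=\omega$ for every $z\in Z$. For a space $X$, $\mathcal{K}_\Omega$ denotes the collection of all families $\mathcal{U}$ of open subsets of $X$ such that $X=\bigcup\{\overline{U}:U\in\mathcal{U}\}$, no element of $\mathcal{U}$ is dense in $X$, and for each finite $F\subseteq X$ there is $U\in\mathcal{U}$ with $F\subseteq\overline{U}$. The space $X$ satisfies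 $S_{\mathrm{fin}}(\mathcal{K}_\Omega,\mathcal{K}_\Omega)$ if for every sequence $(\mathcal{U}_n)_{n\in\mathbb{N}}$ of elements of $\mathcal{K}_\Omega$ there are finite $\mathcal{B}_n\subseteq\mathcal{U}_n$ ($n\in\mathbb{N}$) such that $\bigcup_{n\in\mathbb{N}}\mathcal{B}_n\in\mathcal{K}_\Omega$. *)

theory Defs
  imports "HOL-Analysis.Analysis"
begin

definition quasicontinuous_map :: "'a topology \<Rightarrow> 'b topology \<Rightarrow> ('a \<Rightarrow> 'b) \<Rightarrow> bool" where
  "quasicontinuous_map X Y f \<longleftrightarrow>
     f \<in> topspace X \<rightarrow> topspace Y \<and>
     (\<forall>x \<in> topspace X. \<forall>U V. openin X U \<and> x \<in> U \<and> openin Y V \<and> f x \<in> V \<longrightarrow>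
        (\<exists>W. openin X W \<and> W \<noteq> {} \<and> W \<subseteq> U \<and> f ` W \<subseteq> V))"

text \<open>Functions on the carrier of \<open>X\<close> are represented, as in \<^const>\<open>product_topology\<close>, by
  functions that are \<^const>\<open>undefined\<close> off the carrier.\<close>

definition quasicontinuous_functions :: "'a topology \<Rightarrow> 'b topology \<Rightarrow> ('a \<Rightarrow> 'b) set" where
  "quasicontinuous_functions X Y =
     {f \<in> topspace X \<rightarrow>\<^sub>E topspace Y. quasicontinuous_map X Y f}"

definition Q_p :: "'a topology \<Rightarrow> 'b topology \<Rightarrow> ('a \<Rightarrow> 'b) topology" where
  "Q_p X Y =
     subtopology (product_topology (\<lambda>_. Y) (topspace X)) (quasicontinuous_functions X Y)"

definition countable_fan_tightness_at :: "'a topology \<Rightarrow> 'a \<Rightarrow> bool" where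
  "countable_fan_tightness_at Z z \<longleftrightarrow>
     (\<forall>A :: nat \<Rightarrow> 'a set.
        (\<forall>n. A n \<subseteq> topspace Z \<and> z \<in> Z closure_of (A n)) \<longrightarrow>
        (\<exists>K. (\<forall>n. finite (K n) \<and> K n \<subseteq> A n) \<and> z \<in> Z closure_of (\<Union>n. K n)))"

definition countable_fan_tightness :: "'a topology \<Rightarrow> bool" where
  "countable_fan_tightness Z \<longleftrightarrow> (\<forall>z \<in> topspace Z. countable_fan_tightness_at Z z)"

definition K_Omega :: "'a topology \<Rightarrow> 'a set set set" where
  "K_Omega X =
     {\<U>. (\<forall>U \<in> \<U>. openin X U) \<and>
          topspace X = (\<Union>U \<in> \<U>. X closure_of U) \<and>
          (\<forall>U \<in> \<U>. X closure_of U \<noteq> topspace X) \<and>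
          (\<forall>F. finite F \<and> F \<subseteq> topspace X \<longrightarrow> (\<exists>U \<in> \<U>. F \<subseteq> X closure_of U))}"

definition S_fin :: "'a set set \<Rightarrow> 'a set set \<Rightarrow> bool" where
  "S_fin \<A> \<B> \<longleftrightarrow>
     (\<forall>U :: nat \<Rightarrow> 'a set. (\<forall>n. U n \<in> \<A>) \<longrightarrow>
        (\<exists>B. (\<forall>n. finite (B n) \<and> B n \<subseteq> U n) \<and> (\<Union>n. B n) \<in> \<B>))"

end

theory Submission
  imports Defs
begin

text \<open>Everything is compared with the selection principle for \<^term>\<open>K_Omega X\<close>.

  \<^bold>\<open>Fan tightness at one function gives the selection principle.\<close> Let \<open>f\<close> be quasicontinuous with values
  in a metric space containing \<open>y \<noteq> y'\<close>. There is a quasicontinuous \<open>h\<close>, taking only the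
  values \<open>y\<close> and \<open>y'\<close>, that stays at distance at least \<open>c = d y y' / 2\<close> from \<open>f\<close> at every point
  (\<open>quasicontinuous_map_far\<close>). If \<open>U\<close> is open and \<open>F\<close> is a finite part of its
  closure, \<open>h\<close> can be changed inside the closure of \<open>U\<close> so that it agrees with \<open>f\<close> on \<open>F\<close>
  (\<open>quasicontinuous_map_interpolate\<close>). Given covers \<open>\<U> n\<close>, let \<open>A n\<close> be the set of all
  quasicontinuous \<open>g\<close> which, for some \<open>U \<in> \<U> n\<close>, are \<open>c\<close>-far from \<open>f\<close> off the closure of \<open>U\<close>. Then \<open>f\<close>
  is in the closure of each \<open>A n\<close>, and whenever a selected \<open>g\<close> is \<open>c\<close>-close to \<open>f\<close> on \<open>F\<close>, the
  closure of the corresponding \<open>U\<close> contains \<open>F\<close>.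

  \<^bold>\<open>The selection principle gives fan tightness everywhere.\<close> The naive cover attached to \<open>A n\<close>
  consists of the interiors of the sets where some \<open>g \<in> A n\<close> is close to \<open>f\<close>. It fails for two reasons:
  at a discontinuity of \<open>f\<close>, closeness of \<open>g\<close> to \<open>f\<close> at the point says nothing about nearby points; and
  closeness on an open set does not extend to its closure. The second problem disappears if
  each \<open>U\<close> is built from tiny balls that accumulate only at the chosen points of \<open>F\<close>
  (\<open>nondense_open_with_prescribed_closure\<close>). For the first, the accuracy \<open>e\<close> is fixed.
  The points where \<open>f\<close> oscillates by a fixed amount form a closed nowhere dense set, and the
  selection principle forces closed nowhere dense sets to be countable
  (\<open>countable_nowhere_dense_if_S_fin\<close>), because the same tiny-ball sets cut such a set in finitely
  many points. So, with the bad points enumerated, the \<open>n\<close>-th cover can demand closeness at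
  those of index at most \<open>n\<close> and tolerate errors within \<open>1 / (n + 1)\<close> of a bad point. A point that is not bad has
  a neighbourhood free of bad points, hence the tolerance is harmless for large \<open>n\<close>; and the selected
  member can be forced to have large index, since the finitely many sets selected earlier are not
  dense. Fixing \<open>e\<close> first is essential here: the set of all discontinuities of \<open>f\<close> is countable too,
  but it may be dense. The accuracies \<open>1 / (m + 1)\<close> are combined by splitting the sequence \<open>A\<close> into
  infinitely many subsequences (\<open>finite_selection_fixed_accuracy\<close>,
  \<open>countable_fan_tightness_if_S_fin\<close>).\<close>

section \<open>Quasicontinuous functions\<close>

lemma topspace_Q_p: "topspace (Q_p X Y) = quasicontinuous_functions X Y"
  by (auto simp: Q_p_def quasicontinuous_functions_def)

lemma quasicontinuous_map_const:
  "y \<in> topspace Y \<Longrightarrow> quasicontinuous_map X Y (\<lambda>_. y)"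
  unfolding quasicontinuous_map_def by blast

lemma quasicontinuous_map_cong:
  assumes "quasicontinuous_map X Y f" and "\<And>x. x \<in> topspace X \<Longrightarrow> f x = g x"
  shows "quasicontinuous_map X Y g"
  unfolding quasicontinuous_map_def
proof (intro conjI ballI allI impI)
  show "g \<in> topspace X \<rightarrow> topspace Y"
    using assms by (force simp: quasicontinuous_map_def Pi_iff)
  fix x U V
  assume x: "x \<in> topspace X" and UV: "openin X U \<and> x \<in> U \<and> openin Y V \<and> g x \<in> V"
  then obtain W where W: "openin X W" "W \<noteq> {}" "W \<subseteq> U" "f ` W \<subseteq> V"
    using assms unfolding quasicontinuous_map_def by metis
  moreover have "g ` W = f ` W"
    using assms(2) W(1) openin_subset by (intro image_cong) fastforce+
  ultimately show "\<exists>W. openin X W \<and> W \<noteq> {} \<and> W \<subseteq> U \<and> g ` W \<subseteq> V"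
    by metis
qed

lemma restrict_in_quasicontinuous_functions:
  assumes "quasicontinuous_map X Y g"
  shows "restrict g (topspace X) \<in> quasicontinuous_functions X Y"
proof -
  have "quasicontinuous_map X Y (restrict g (topspace X))"
    using quasicontinuous_map_cong [OF assms, of "restrict g (topspace X)"] by simp
  moreover have "g \<in> topspace X \<rightarrow> topspace Y"
    using assms by (simp add: quasicontinuous_map_def)
  ultimately show ?thesis
    by (auto simp: quasicontinuous_functions_def)
qed

lemma Q_p_nonempty:
  assumes "y \<in> topspace Y"
  obtains f where "f \<in> topspace (Q_p X Y)"
  using restrict_in_quasicontinuous_functions [OF quasicontinuous_map_const [OF assms]] that
  unfolding topspace_Q_p by blast

text \<open>The closure of an open set is the right domain for a redefinition: a point of the closure sees
  the new value on nearby points of \<open>V\<close>, and the rest of the space is open.\<close>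

lemma quasicontinuous_map_if_closure_of:
  assumes h: "quasicontinuous_map X Y h" and V: "openin X V" and y: "y \<in> topspace Y"
  shows "quasicontinuous_map X Y (\<lambda>z. if z \<in> X closure_of V then y else h z)"
  unfolding quasicontinuous_map_def
proof (intro conjI ballI allI impI)
  show "(\<lambda>z. if z \<in> X closure_of V then y else h z) \<in> topspace X \<rightarrow> topspace Y"
    using h y by (auto simp: quasicontinuous_map_def)
next
  fix x U T
  assume x: "x \<in> topspace X"
    and *: "openin X U \<and> x \<in> U \<and> openin Y T \<and> (if x \<in> X closure_of V then y else h x) \<in> T"
  show "\<exists>W. openin X W \<and> W \<noteq> {} \<and> W \<subseteq> U \<and>
      (\<lambda>z. if z \<in> X closure_of V then y else h z) ` W \<subseteq> T"
  proof (cases "x \<in> X closure_of V")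
    case True
    then have "U \<inter> V \<noteq> {}"
      using * by (metis in_closure_of disjoint_iff)
    moreover have "V \<subseteq> X closure_of V"
      by (simp add: V closure_of_subset openin_subset)
    ultimately show ?thesis
      using * True V by (intro exI [of _ "U \<inter> V"]) auto
  next
    case False
    have "openin X (U - X closure_of V)"
      using * by (simp add: openin_diff)
    moreover have "x \<in> U - X closure_of V" "h x \<in> T"
      using * False by auto
    ultimately obtain W where "openin X W" "W \<noteq> {}" "W \<subseteq> U - X closure_of V" "h ` W \<subseteq> T"
      using h x * unfolding quasicontinuous_map_def by meson
    then show ?thesis
      by (intro exI [of _ W]) auto
  qed
qed

text \<open>The points of \<open>F\<close> are treated one at a time. At \<open>x\<close> the function is made constant on the closure
  of \<open>P \<inter> U\<close>, where \<open>P\<close> is a neighbourhood of \<open>x\<close> whose closure misses the points already treated.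
  The new constant \<open>f x\<close> is used, rather than \<open>f\<close> itself, because the value \<open>f x\<close> need not be
  approached by \<open>f\<close> from within \<open>U\<close>.\<close>

lemma quasicontinuous_map_interpolate:
  assumes X: "regular_space X" "t1_space X"
    and f: "f \<in> topspace X \<rightarrow> topspace Y" and h: "quasicontinuous_map X Y h"
    and U: "openin X U" and F: "finite F" "F \<subseteq> X closure_of U"
  shows "\<exists>g. quasicontinuous_map X Y g \<and> (\<forall>x\<in>F. g x = f x) \<and> (\<forall>z. z \<notin> X closure_of U \<longrightarrow> g z = h z)"
  using F
proof (induction F rule: finite_induct)
  case empty
  then show ?case using h by auto
next
  case (insert x F)
  then obtain g where g: "quasicontinuous_map X Y g" "\<And>x. x \<in> F \<Longrightarrow> g x = f x"
      "\<And>z. z \<notin> X closure_of U \<Longrightarrow> g z = h z"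
    by auto
  have FX: "F \<subseteq> topspace X" and xX: "x \<in> topspace X"
    using insert.prems closure_of_subset_topspace by fast+
  have "openin X (topspace X - F)"
    using X(2) insert.hyps(1) FX by (simp add: t1_space_closedin_finite openin_diff)
  then obtain P C where P: "openin X P" "closedin X C" "x \<in> P" "P \<subseteq> C" "C \<subseteq> topspace X - F"
    using X(1) xX insert.hyps(2)
    unfolding neighbourhood_base_of_closedin [symmetric] neighbourhood_base_of
    by (metis DiffI)
  define V where "V = P \<inter> U"
  have V: "openin X V" "X closure_of V \<subseteq> X closure_of U" "X closure_of V \<subseteq> C"
    using P U by (auto simp: V_def closure_of_mono closure_of_minimal le_infI1)
  have xV: "x \<in> X closure_of V"
    using openin_Int_closure_of_subset [OF P(1), of U] P(3) insert.prems by (auto simp: V_def)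
  define g' where "g' = (\<lambda>z. if z \<in> X closure_of V then f x else g z)"
  have "quasicontinuous_map X Y g'"
    unfolding g'_def using f xX
    by (intro quasicontinuous_map_if_closure_of g V) auto
  moreover have "\<forall>z\<in>insert x F. g' z = f z"
    using xV V(3) P(5) g(2) by (auto simp: g'_def)
  moreover have "\<forall>z. z \<notin> X closure_of U \<longrightarrow> g' z = h z"
    using V(2) g(3) by (auto simp: g'_def)
  ultimately show ?case by blast
qed

context Metric_space
begin

lemma quasicontinuous_mapD:
  assumes "quasicontinuous_map X mtopology f" "openin X U" "x \<in> U" "0 < e"
  obtains W where "openin X W" "W \<noteq> {}" "W \<subseteq> U" "\<And>w. w \<in> W \<Longrightarrow> d (f x) (f w) < e"
proof -
  have "x \<in> topspace X" "f x \<in> M"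
    using assms openin_subset by (force simp: quasicontinuous_map_def)+
  then have "\<exists>W. openin X W \<and> W \<noteq> {} \<and> W \<subseteq> U \<and> f ` W \<subseteq> mball (f x) e"
    using assms unfolding quasicontinuous_map_def by (metis centre_in_mball_iff openin_mball)
  then show ?thesis
    using that by (metis image_subset_iff in_mball)
qed

text \<open>The naive choice, \<open>y'\<close> where \<open>f\<close> is within \<open>c\<close> of \<open>y\<close> and \<open>y\<close> elsewhere, stays \<open>c\<close> away from \<open>f\<close> but
  need not be quasicontinuous: a point outside
  \<open>E = {z. d (f z) y < c}\<close> may be surrounded by points of the closure of \<open>E\<close>. Quasicontinuity of \<open>f\<close> then gives
  \<open>d (f z) y \<le> c\<close> as well, so such a point can be given the value \<open>y'\<close> too.\<close>

lemma quasicontinuous_map_far: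
  assumes f: "quasicontinuous_map X mtopology f" and y: "y \<in> M" "y' \<in> M"
  obtains h where "quasicontinuous_map X mtopology h"
    "\<And>z. z \<in> topspace X \<Longrightarrow> d y y' / 2 \<le> d (f z) (h z)"
proof -
  define c where "c = d y y' / 2"
  have fM: "f z \<in> M" if "z \<in> topspace X" for z
    using f that by (auto simp: quasicontinuous_map_def)
  define E where "E = {z \<in> topspace X. d (f z) y < c}"
  define H where "H = X interior_of (topspace X - E)"
  \<comment> \<open>The set where \<open>h\<close> takes the value \<open>y\<close>; it and its complement each lie in the closure of their interior.\<close>
  define A where "A = X closure_of H - E"
  define h where "h = (\<lambda>z. if z \<in> A then y else y')"
  have HE: "H \<inter> E = {}"
    unfolding H_def using interior_of_subset by fastforce
  have H: "openin X H"
    by (simp add: H_def)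
  have E_near: "\<exists>W. openin X W \<and> W \<noteq> {} \<and> W \<subseteq> U \<inter> E" if z: "z \<in> E" "z \<in> U" "openin X U" for z U
  proof -
    have "0 < c - d (f z) y"
      using z by (simp add: E_def)
    then obtain W where W: "openin X W" "W \<noteq> {}" "W \<subseteq> U" "\<And>w. w \<in> W \<Longrightarrow> d (f z) (f w) < c - d (f z) y"
      using quasicontinuous_mapD [OF f] z by metis
    have "w \<in> E" if "w \<in> W" for w
    proof -
      have "w \<in> topspace X" using W(1) that openin_subset by blast
      moreover have "z \<in> topspace X" using z by (simp add: E_def)
      ultimately have "d (f w) y \<le> d (f z) (f w) + d (f z) y"
        using triangle'[of "f w" "f z" y] fM y commute by metis
      then show ?thesis
        using W(4)[OF that] \<open>w \<in> topspace X\<close> by (simp add: E_def)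
    qed
    then show ?thesis using W by blast
  qed
  have loc: "\<exists>W. openin X W \<and> W \<noteq> {} \<and> W \<subseteq> U \<and> (\<forall>w\<in>W. h w = h z)"
    if z: "z \<in> topspace X" "z \<in> U" "openin X U" for z U
  proof (cases "z \<in> A")
    case True
    then have "U \<inter> H \<noteq> {}"
      using z by (auto simp: A_def in_closure_of)
    moreover have "H \<subseteq> A"
      using HE closure_of_subset [OF openin_subset [OF H]] by (auto simp: A_def)
    ultimately show ?thesis
      using True z H by (intro exI [of _ "U \<inter> H"]) (auto simp: h_def)
  next
    case False
    have "\<exists>e. e \<in> U \<inter> E"
    proof (rule ccontr)
      assume "\<not> ?thesis"
      then have "U \<subseteq> H"
        unfolding H_def using z by (intro interior_of_maximal) (use openin_subset in blast)+
      then show False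
        using False z closure_of_subset [OF openin_subset [OF H]] HE by (auto simp: A_def)
    qed
    then obtain W where "openin X W" "W \<noteq> {}" "W \<subseteq> U \<inter> E"
      using E_near z by blast
    then show ?thesis
      using False by (intro exI [of _ W]) (auto simp: h_def A_def)
  qed
  have "quasicontinuous_map X mtopology h"
    unfolding quasicontinuous_map_def
  proof (intro conjI ballI allI impI)
    show "h \<in> topspace X \<rightarrow> topspace mtopology"
      using y by (simp add: h_def)
    fix x U V
    assume "x \<in> topspace X" "openin X U \<and> x \<in> U \<and> openin mtopology V \<and> h x \<in> V"
    then show "\<exists>W. openin X W \<and> W \<noteq> {} \<and> W \<subseteq> U \<and> h ` W \<subseteq> V"
      using loc [of x U] by (metis image_subsetI)
  qed
  moreover have "c \<le> d (f z) (h z)" if z: "z \<in> topspace X" for z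
  proof (cases "z \<in> A")
    case True
    then show ?thesis
      using z by (auto simp: A_def E_def h_def)
  next
    case False
    have "d (f z) y \<le> c"
    proof (rule ccontr)
      assume "\<not> ?thesis"
      then have pos: "0 < d (f z) y - c" and zE: "z \<notin> E"
        by (auto simp: E_def)
      have "z \<notin> X closure_of H"
        using False zE by (simp add: A_def)
      then have "openin X (topspace X - X closure_of H)" "z \<in> topspace X - X closure_of H"
        using z by (auto simp: openin_diff)
      then obtain W where W: "openin X W" "W \<noteq> {}" "W \<subseteq> topspace X - X closure_of H"
          "\<And>w. w \<in> W \<Longrightarrow> d (f z) (f w) < d (f z) y - c"
        using quasicontinuous_mapD [OF f _ _ pos] by metis
      have "w \<notin> E" if "w \<in> W" for w
      proof -
        have "w \<in> topspace X" using W(3) that by blast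
        then have "d (f z) y \<le> d (f z) (f w) + d (f w) y"
          using triangle fM z y by simp
        then show ?thesis
          using W(4)[OF that] by (simp add: E_def)
      qed
      then have "W \<subseteq> H"
        unfolding H_def using W by (intro interior_of_maximal) auto
      then show False
        using W closure_of_subset [OF openin_subset [OF H]] by blast
    qed
    moreover have "d y y' \<le> d (f z) y + d (f z) y'"
      using triangle''[of y "f z" y'] y fM z commute by (metis triangle)
    ultimately show ?thesis
      using False by (simp add: h_def c_def)
  qed
  ultimately show ?thesis
    using that unfolding c_def by blast
qed

section \<open>Pointwise closure\<close>

lemma in_closure_of_Q_p:
  assumes A: "A \<subseteq> quasicontinuous_functions X mtopology"
  shows "f \<in> Q_p X mtopology closure_of A \<longleftrightarrow>
    f \<in> quasicontinuous_functions X mtopology \<and>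
    (\<forall>F e. finite F \<and> F \<subseteq> topspace X \<and> 0 < e \<longrightarrow> (\<exists>g\<in>A. \<forall>x\<in>F. d (f x) (g x) < e))"
    (is "?L \<longleftrightarrow> ?f \<and> ?R")
proof (cases ?f)
  case False
  then show ?thesis
    by (metis topspace_Q_p in_closure_of)
next
  case f: True
  let ?P = "product_topology (\<lambda>_. mtopology) (topspace X)"
  have f': "f \<in> topspace X \<rightarrow>\<^sub>E M"
    using f by (simp add: quasicontinuous_functions_def)
  have A': "A \<subseteq> topspace X \<rightarrow>\<^sub>E M"
    using A by (auto simp: quasicontinuous_functions_def)
  have "?L \<longleftrightarrow> f \<in> ?P closure_of A"
    using f A by (simp add: Q_p_def closure_of_subtopology Int_absorb1)
  also have "\<dots> \<longleftrightarrow> ?R"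
  proof
    assume L: "f \<in> ?P closure_of A"
    show ?R
    proof (intro allI impI)
      fix F and e :: real
      assume F: "finite F \<and> F \<subseteq> topspace X \<and> 0 < e"
      let ?B = "\<lambda>x. if x \<in> F then mball (f x) e else M"
      have fin: "finite {x \<in> topspace X. ?B x \<noteq> topspace mtopology}"
        using F by (auto intro: finite_subset [of _ F])
      have "openin ?P (PiE (topspace X) ?B)"
        unfolding openin_PiE_gen using fin openin_topspace [of mtopology] by auto
      moreover have "f \<in> PiE (topspace X) ?B"
        using f' F by (auto simp: PiE_iff)
      ultimately obtain g where "g \<in> A" "g \<in> PiE (topspace X) ?B"
        using L unfolding in_closure_of by blast
      then show "\<exists>g\<in>A. \<forall>x\<in>F. d (f x) (g x) < e"
        using F by (intro bexI [of _ g]) (force simp: PiE_iff subset_iff)+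
    qed
  next
    assume R: ?R
    show "f \<in> ?P closure_of A"
      unfolding in_closure_of
    proof (intro conjI allI impI)
      show "f \<in> topspace ?P"
        using f' by simp
      fix T assume T: "f \<in> T \<and> openin ?P T"
      then obtain B where B: "f \<in> PiE (topspace X) B" "\<And>i. openin mtopology (B i)"
          "finite {i. B i \<noteq> M}" "PiE (topspace X) B \<subseteq> T"
        using product_topology_open_contains_basis [of "\<lambda>_. mtopology" "topspace X" T f] by auto
      define F where "F = {i \<in> topspace X. B i \<noteq> M}"
      have F: "finite F" "F \<subseteq> topspace X"
        using B(3) by (auto simp: F_def intro: finite_subset)
      have "\<exists>r>0. mball (f i) r \<subseteq> B i" if "i \<in> topspace X" for i
        using B(1,2) that by (force simp: openin_mtopology PiE_iff)
      then obtain r where r: "\<And>i. i \<in> topspace X \<Longrightarrow> 0 < r i \<and> mball (f i) (r i) \<subseteq> B i"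
        by metis
      define e where "e = Min (insert 1 (r ` F))"
      have "0 < e"
        unfolding e_def using F r by (subst Min_gr_iff) auto
      then obtain g where g: "g \<in> A" "\<And>x. x \<in> F \<Longrightarrow> d (f x) (g x) < e"
        using R [rule_format, of F e] F by auto
      have e: "e \<le> r x" if "x \<in> F" for x
        using F that by (simp add: e_def)
      have gA: "g \<in> topspace X \<rightarrow>\<^sub>E M"
        using g(1) A' by blast
      have "g x \<in> B x" if x: "x \<in> topspace X" for x
      proof (cases "x \<in> F")
        case True
        then have "g x \<in> mball (f x) (r x)"
          using g(2) e gA f' x by (fastforce simp: PiE_iff)
        then show ?thesis using r x by blast
      next
        case False
        then show ?thesis using gA x by (auto simp: F_def)
      qed
      then have "g \<in> T"
        using B(4) gA by (auto simp: PiE_iff subset_iff)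
      then show "\<exists>y. y \<in> A \<and> y \<in> T"
        using g(1) by blast
    qed
  qed
  finally show ?thesis using f by simp
qed

end

section \<open>From countable fan tightness to the selection principle\<close>

lemma K_OmegaD:
  assumes "\<U> \<in> K_Omega X"
  shows "U \<in> \<U> \<Longrightarrow> openin X U" and "U \<in> \<U> \<Longrightarrow> X closure_of U \<noteq> topspace X"
    and "finite F \<Longrightarrow> F \<subseteq> topspace X \<Longrightarrow> \<exists>U\<in>\<U>. F \<subseteq> X closure_of U"
  using assms unfolding K_Omega_def mem_Collect_eq by metis+

lemma K_OmegaI:
  assumes "\<And>U. U \<in> \<U> \<Longrightarrow> openin X U" and "\<And>U. U \<in> \<U> \<Longrightarrow> X closure_of U \<noteq> topspace X"
    and "\<And>F. finite F \<Longrightarrow> F \<subseteq> topspace X \<Longrightarrow> \<exists>U\<in>\<U>. F \<subseteq> X closure_of U"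
  shows "\<U> \<in> K_Omega X"
proof -
  have "\<exists>U\<in>\<U>. x \<in> X closure_of U" if "x \<in> topspace X" for x
    using assms(3)[of "{x}"] that by auto
  then have "topspace X = (\<Union>U\<in>\<U>. X closure_of U)"
    using closure_of_subset_topspace by fast
  then show ?thesis
    using assms by (simp add: K_Omega_def)
qed

lemma (in Metric_space) S_fin_if_countable_fan_tightness_at:
  assumes X: "regular_space X" "t1_space X"
    and y: "y \<in> M" "y' \<in> M" "y \<noteq> y'"
    and f: "f \<in> quasicontinuous_functions X mtopology"
    and vet: "countable_fan_tightness_at (Q_p X mtopology) f"
  shows "S_fin (K_Omega X) (K_Omega X)"
  unfolding S_fin_def
proof (intro allI impI)
  fix \<U> :: "nat \<Rightarrow> 'b set set"
  assume \<U>: "\<forall>n. \<U> n \<in> K_Omega X"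
  let ?Q = "quasicontinuous_functions X mtopology"
  have fq: "quasicontinuous_map X mtopology f"
    using f by (simp add: quasicontinuous_functions_def)
  define c where "c = d y y' / 2"
  have "0 < c"
    using y by (simp add: c_def)
  obtain h where h: "quasicontinuous_map X mtopology h"
      "\<And>z. z \<in> topspace X \<Longrightarrow> c \<le> d (f z) (h z)"
    using quasicontinuous_map_far [OF fq y(1,2)] unfolding c_def by blast
  define far where "far = (\<lambda>U g. \<forall>z \<in> topspace X - X closure_of U. c \<le> d (f z) (g z))"
  \<comment> \<open>The functions \<open>g\<close> that reveal, by being close to \<open>f\<close>, which points lie in the closure of a member of \<open>\<U> n\<close>.\<close>
  define A where "A = (\<lambda>n. {g \<in> ?Q. \<exists>U\<in>\<U> n. far U g})"
  have fA: "f \<in> Q_p X mtopology closure_of A n" for n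
  proof (subst in_closure_of_Q_p)
    show "A n \<subseteq> ?Q"
      by (auto simp: A_def)
    have "\<exists>g\<in>A n. \<forall>x\<in>F. d (f x) (g x) < e" if F: "finite F" "F \<subseteq> topspace X" and e: "0 < e" for F e
    proof -
      obtain U where U: "U \<in> \<U> n" "openin X U" "F \<subseteq> X closure_of U"
        using K_OmegaD(1,3) \<U> F by metis
      have "f \<in> topspace X \<rightarrow> topspace mtopology"
        using fq by (simp add: quasicontinuous_map_def)
      then obtain g where g: "quasicontinuous_map X mtopology g" "\<forall>x\<in>F. g x = f x"
          "\<forall>z. z \<notin> X closure_of U \<longrightarrow> g z = h z"
        using quasicontinuous_map_interpolate [OF X _ h(1) U(2) F(1) U(3)] by blast
      have "far U (restrict g (topspace X))"
        using g(3) h(2) by (auto simp: far_def)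
      then have "restrict g (topspace X) \<in> A n"
        using U(1) restrict_in_quasicontinuous_functions [OF g(1)] by (auto simp: A_def)
      moreover have "d (f x) (restrict g (topspace X) x) < e" if "x \<in> F" for x
        using that F(2) g(2) e \<open>f \<in> topspace X \<rightarrow> topspace mtopology\<close> by (auto simp: subset_iff Pi_iff)
      ultimately show ?thesis by blast
    qed
    then show "f \<in> ?Q \<and> (\<forall>F e. finite F \<and> F \<subseteq> topspace X \<and> 0 < e \<longrightarrow> (\<exists>g\<in>A n. \<forall>x\<in>F. d (f x) (g x) < e))"
      using f by blast
  qed
  have "A n \<subseteq> topspace (Q_p X mtopology)" for n
    by (auto simp: A_def topspace_Q_p)
  then obtain K where K: "\<And>n. finite (K n)" "\<And>n. K n \<subseteq> A n"
      and fK: "f \<in> Q_p X mtopology closure_of (\<Union>n. K n)"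
    using vet [unfolded countable_fan_tightness_at_def, rule_format, of A] fA by metis
  have "\<forall>n. \<forall>g\<in>K n. \<exists>U\<in>\<U> n. far U g"
    using K(2) by (auto simp: A_def)
  then obtain u where u: "\<And>n g. g \<in> K n \<Longrightarrow> u n g \<in> \<U> n \<and> far (u n g) g"
    by metis
  define B where "B = (\<lambda>n. u n ` K n)"
  have BU: "B n \<subseteq> \<U> n" for n
    using u by (auto simp: B_def)
  have "(\<Union>n. B n) \<in> K_Omega X"
  proof (rule K_OmegaI)
    fix U assume "U \<in> (\<Union>n. B n)"
    then obtain n where "U \<in> \<U> n"
      using BU by blast
    then show "openin X U" "X closure_of U \<noteq> topspace X"
      using K_OmegaD(1,2) \<U> by metis+
  next
    fix F assume F: "finite F" "F \<subseteq> topspace X"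
    have "(\<Union>n. K n) \<subseteq> ?Q"
      using K(2) by (auto simp: A_def)
    from in_closure_of_Q_p [OF this] fK F \<open>0 < c\<close>
    obtain g where "g \<in> (\<Union>n. K n)" and g: "\<forall>x\<in>F. d (f x) (g x) < c"
      by metis
    then obtain n where n: "g \<in> K n" by blast
    have "F \<subseteq> X closure_of (u n g)"
    proof (rule subsetI, rule ccontr)
      fix x assume x: "x \<in> F" "x \<notin> X closure_of (u n g)"
      then have "c \<le> d (f x) (g x)"
        using u [OF n] F(2) unfolding far_def by blast
      then show False
        using g x(1) by force
    qed
    then show "\<exists>U\<in>\<Union>n. B n. F \<subseteq> X closure_of U"
      using n by (auto simp: B_def)
  qed
  then show "\<exists>B. (\<forall>n. finite (B n) \<and> B n \<subseteq> \<U> n) \<and> (\<Union>n. B n) \<in> K_Omega X"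
    using BU K(1) by (intro exI [of _ B]) (auto simp: B_def)
qed

section \<open>Nowhere dense sets and the selection principle\<close>

context Metric_space
begin

text \<open>The set consists of balls inside \<open>G\<close> whose centres converge to \<open>x\<close> and whose radii tend to 0; away from \<open>x\<close>
  the closure involves only finitely many of them.\<close>

lemma shrink_open_at_closure_point:
  assumes G: "openin mtopology G" and x: "x \<in> mtopology closure_of G"
  obtains U where "openin mtopology U" "x \<in> mtopology closure_of U"
    "mtopology closure_of U \<subseteq> insert x G"
proof -
  have xM: "x \<in> M"
    using x by (simp add: metric_closure_of)
  have "\<exists>y s. 0 < s \<and> y \<in> M \<and> d x y < inverse (Suc n) \<and> s < inverse (Suc n) \<and> mcball y s \<subseteq> G" for n
  proof -
    have pos: "0 < inverse (real (Suc n))" by simp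
    then obtain y where y: "y \<in> G" "y \<in> mball x (inverse (Suc n))"
      using x unfolding metric_closure_of by blast
    then obtain r where r: "0 < r" "mcball y r \<subseteq> G"
      using G openin_mtopology_mcball by blast
    obtain s where "0 < s" "s < r" "s < inverse (Suc n)"
      using field_lbound_gt_zero [OF r(1) pos] by blast
    then show ?thesis
      using y r mcball_subset_concentric [of s r y] by (intro exI [of _ y] exI [of _ s]) auto
  qed
  then obtain y s where ys: "\<And>n. 0 < s n" "\<And>n. y n \<in> M" "\<And>n. d x (y n) < inverse (Suc n)"
      "\<And>n. s n < inverse (Suc n)" "\<And>n. mcball (y n) (s n) \<subseteq> G"
    by metis
  define U where "U = (\<Union>n. mball (y n) (s n))"
  have "openin mtopology U"
    unfolding U_def by auto
  moreover have "x \<in> mtopology closure_of U"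
    unfolding metric_closure_of
  proof (intro CollectI conjI allI impI xM)
    fix r :: real assume "0 < r"
    then obtain n where "inverse (Suc n) < r"
      using reals_Archimedean by blast
    moreover have "y n \<in> mball (y n) (s n)"
      using ys(1,2) by simp
    then have "y n \<in> U"
      unfolding U_def by blast
    ultimately show "\<exists>u\<in>U. u \<in> mball x r"
      using ys(2,3)[of n] xM by (intro bexI [of _ "y n"]) auto
  qed
  moreover have "z \<in> G" if z: "z \<in> mtopology closure_of U" "z \<noteq> x" for z
  proof -
    have zM: "z \<in> M"
      using z by (simp add: metric_closure_of)
    then have "0 < d x z / 4"
      using z xM by simp
    then obtain N where N: "inverse (Suc N) < d x z / 4"
      using reals_Archimedean by blast
    have far: "mball z (d x z / 2) \<inter> mball (y n) (s n) = {}" if "N \<le> n" for n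
    proof (rule ccontr)
      assume "\<not> ?thesis"
      then obtain w where w: "w \<in> M" "d z w < d x z / 2" "d (y n) w < s n"
        by auto
      have "inverse (Suc n) \<le> inverse (real (Suc N))"
        using that by simp
      moreover have "d x z \<le> d x (y n) + d (y n) w + d w z"
        using triangle [OF xM ys(2) zM, of n] triangle [OF ys(2) w(1) zM, of n] by linarith
      ultimately show False
        using w N ys(3,4)[of n] commute [of w z] by linarith
    qed
    have "z \<in> mball z (d x z / 2)" "openin mtopology (mball z (d x z / 2))"
      using zM \<open>0 < d x z / 4\<close> by auto
    then have "z \<in> mtopology closure_of (mball z (d x z / 2) \<inter> U)"
      using openin_Int_closure_of_subset z by blast
    moreover have "mball z (d x z / 2) \<inter> U \<subseteq> (\<Union>n<N. mcball (y n) (s n))"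
    proof
      fix w assume w: "w \<in> mball z (d x z / 2) \<inter> U"
      then obtain n where n: "w \<in> mball (y n) (s n)"
        by (auto simp: U_def)
      then have "n < N"
        using far [of n] w by (meson IntE disjoint_iff not_le)
      then show "w \<in> (\<Union>n<N. mcball (y n) (s n))"
        using n mball_subset_mcball by blast
    qed
    moreover have "closedin mtopology (\<Union>n<N. mcball (y n) (s n))"
      by (intro closedin_Union) auto
    ultimately have "z \<in> (\<Union>n<N. mcball (y n) (s n))"
      by (meson closure_of_minimal subsetD)
    then show ?thesis
      using ys(5) by blast
  qed
  ultimately show ?thesis
    using that by blast
qed

text \<open>A supply of members for elements of \<^const>\<open>K_Omega\<close>: the closure captures \<open>F\<close>, and every other point of
  the closure is under control. Since \<open>M\<close> is infinite, there is a point outside \<open>F\<close>, and balls around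
  \<open>F\<close> that are small enough stay away from it; so \<open>U\<close> is not dense.\<close>

lemma nondense_open_with_prescribed_closure:
  assumes M: "infinite M" and F: "finite F" "F \<subseteq> M" and r: "0 < r"
    and G: "\<And>x. x \<in> F \<Longrightarrow> openin mtopology (G x) \<and> x \<in> mtopology closure_of (G x)"
  obtains U where "openin mtopology U" "F \<subseteq> mtopology closure_of U" "mtopology closure_of U \<noteq> M"
    "\<And>z. z \<in> mtopology closure_of U \<Longrightarrow> z \<in> F \<or> (\<exists>x\<in>F. z \<in> G x \<and> d x z < r)"
proof -
  obtain p where p: "p \<in> M" "p \<notin> F"
    using M F by (metis finite_subset subsetI)
  define s where "s = Min (insert r ((\<lambda>x. d x p) ` F))"
  have "0 < s"
    unfolding s_def using F p r by (subst Min_gr_iff) (auto simp: subset_iff)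
  have s: "s \<le> r" "\<And>x. x \<in> F \<Longrightarrow> s \<le> d x p"
    using F by (auto simp: s_def)
  have "\<exists>U. openin mtopology U \<and> x \<in> mtopology closure_of U \<and>
      mtopology closure_of U \<subseteq> insert x (mball x s \<inter> G x)" if x: "x \<in> F" for x
  proof -
    have "x \<in> mball x s"
      using x F \<open>0 < s\<close> by auto
    then have "openin mtopology (mball x s \<inter> G x)" "x \<in> mtopology closure_of (mball x s \<inter> G x)"
      using G [OF x] openin_Int_closure_of_subset [OF openin_mball, of x s "G x"] by auto
    then show ?thesis
      using shrink_open_at_closure_point by metis
  qed
  then obtain V where V: "\<And>x. x \<in> F \<Longrightarrow> openin mtopology (V x)"
      "\<And>x. x \<in> F \<Longrightarrow> x \<in> mtopology closure_of (V x)"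
      "\<And>x. x \<in> F \<Longrightarrow> mtopology closure_of (V x) \<subseteq> insert x (mball x s \<inter> G x)"
    by metis
  define U where "U = (\<Union>x\<in>F. V x)"
  have cl: "mtopology closure_of U = (\<Union>x\<in>F. mtopology closure_of (V x))"
    unfolding U_def using F by (subst closure_of_Union) auto
  have "p \<notin> mtopology closure_of U"
    using V(3) s(2) p by (fastforce simp: cl)
  moreover have "openin mtopology U"
    unfolding U_def using V(1) by blast
  moreover have "F \<subseteq> mtopology closure_of U"
    using V(2) by (auto simp: cl)
  moreover have "z \<in> F \<or> (\<exists>x\<in>F. z \<in> G x \<and> d x z < r)" if "z \<in> mtopology closure_of U" for z
    using that V(3) s(1) by (fastforce simp: cl)
  ultimately show ?thesis
    using that p(1) by blast
qed

text \<open>The open sets whose closure meets \<open>M - G\<close> in a finite set only form an element of \<^const>\<open>K_Omega\<close>. The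
  countably many that are selected still cover.\<close>

lemma countable_nowhere_dense_if_S_fin:
  assumes S: "S_fin (K_Omega mtopology) (K_Omega mtopology)"
    and G: "openin mtopology G" "mtopology closure_of G = M"
  shows "countable (M - G)"
proof (cases "finite M")
  case True
  then show ?thesis
    by (simp add: countable_finite)
next
  case False
  define \<U> where "\<U> = {U. openin mtopology U \<and> mtopology closure_of U \<noteq> M \<and>
      finite (mtopology closure_of U - G)}"
  have "\<U> \<in> K_Omega mtopology"
  proof (rule K_OmegaI)
    fix F assume F: "finite F" "F \<subseteq> topspace mtopology"
    then obtain U where U: "openin mtopology U" "F \<subseteq> mtopology closure_of U"
        "mtopology closure_of U \<noteq> M"
        "\<And>z. z \<in> mtopology closure_of U \<Longrightarrow> z \<in> F \<or> (\<exists>x\<in>F. z \<in> G \<and> d x z < 1)"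
      using nondense_open_with_prescribed_closure [OF False F(1), of 1 "\<lambda>_. G"] G
      by (simp add: subset_iff) blast
    have "mtopology closure_of U - G \<subseteq> F"
      using U(4) by blast
    then have "finite (mtopology closure_of U - G)"
      using F(1) by (rule finite_subset)
    then have "U \<in> \<U>"
      unfolding \<U>_def using U(1,3) by simp
    then show "\<exists>U\<in>\<U>. F \<subseteq> mtopology closure_of U"
      using U(2) by blast
  qed (auto simp: \<U>_def)
  then obtain B where B: "\<And>n::nat. finite (B n)" "\<And>n. B n \<subseteq> \<U>" "(\<Union>n. B n) \<in> K_Omega mtopology"
    using S [unfolded S_fin_def, rule_format, of "\<lambda>_. \<U>"] by auto
  have "M = (\<Union>U\<in>(\<Union>n. B n). mtopology closure_of U)"
    using B(3) unfolding K_Omega_def by auto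
  then have "M - G = (\<Union>U\<in>(\<Union>n. B n). mtopology closure_of U - G)"
    by blast
  moreover have "countable (\<Union>n. B n)"
    using B(1) by (simp add: countable_finite)
  moreover have "countable (mtopology closure_of U - G)" if "U \<in> (\<Union>n. B n)" for U
    using that B(2) by (auto simp: \<U>_def intro: countable_finite)
  ultimately show ?thesis
    by (metis (no_types, lifting) countable_UN)
qed

end

section \<open>From the selection principle to countable fan tightness\<close>

definition (in Metric_space) small_oscillation :: "'x topology \<Rightarrow> ('x \<Rightarrow> 'a) \<Rightarrow> real \<Rightarrow> 'x set" where
  "small_oscillation X f e = \<Union>{P. openin X P \<and> (\<forall>y\<in>P. \<forall>z\<in>P. d (f y) (f z) < e)}"

lemma (in Metric_space) openin_small_oscillation: "openin X (small_oscillation X f e)"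
  by (auto simp: small_oscillation_def)

lemma (in Metric_space) dense_small_oscillation:
  assumes f: "quasicontinuous_map X mtopology f" and e: "0 < e"
  shows "X closure_of small_oscillation X f e = topspace X"
proof (rule antisym [OF closure_of_subset_topspace], rule subsetI)
  fix x assume x: "x \<in> topspace X"
  show "x \<in> X closure_of small_oscillation X f e"
    unfolding in_closure_of
  proof (intro conjI allI impI x)
    fix T assume T: "x \<in> T \<and> openin X T"
    have "0 < e / 2" using e by simp
    then obtain W where W: "openin X W" "W \<noteq> {}" "W \<subseteq> T" "\<And>w. w \<in> W \<Longrightarrow> d (f x) (f w) < e / 2"
      using quasicontinuous_mapD [OF f] T by metis
    have fM: "f z \<in> M" if "z \<in> topspace X" for z
      using f that by (auto simp: quasicontinuous_map_def)
    have "d (f y) (f z) < e" if "y \<in> W" "z \<in> W" for y z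
    proof -
      have "y \<in> topspace X" "z \<in> topspace X"
        using that W(1) openin_subset by blast+
      then have "d (f y) (f z) \<le> d (f x) (f y) + d (f x) (f z)"
        using triangle'' fM x commute by (metis triangle)
      then show ?thesis
        using W(4) [OF that(1)] W(4) [OF that(2)] by linarith
    qed
    then have "W \<subseteq> small_oscillation X f e"
      using W(1) by (auto simp: small_oscillation_def)
    then show "\<exists>y. y \<in> small_oscillation X f e \<and> y \<in> T"
      using W by blast
  qed
qed

text \<open>At a point where \<open>f\<close> barely oscillates, closeness of two quasicontinuous functions spreads to
  open sets accumulating there. Without a bound on the oscillation this fails: the indicator
  functions of \<open>{0..}\<close> and \<open>{..0}\<close> on the line agree at 0 and nowhere else.\<close>

lemma (in Metric_space) in_closure_of_interior_close:
  assumes f: "quasicontinuous_map X mtopology f" and g: "quasicontinuous_map X mtopology g"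
    and x: "x \<in> small_oscillation X f (e/3)" "d (f x) (g x) < e/3" and e: "0 < e"
  shows "x \<in> X closure_of (X interior_of {y \<in> topspace X. d (f y) (g y) < e})"
proof -
  have fM: "f z \<in> M" and gM: "g z \<in> M" if "z \<in> topspace X" for z
    using f g that by (auto simp: quasicontinuous_map_def)
  have xX: "x \<in> topspace X"
    using openin_subset [OF openin_small_oscillation] x(1) by (rule subsetD)
  obtain P where P: "openin X P" "x \<in> P" "\<And>y z. y \<in> P \<Longrightarrow> z \<in> P \<Longrightarrow> d (f y) (f z) < e/3"
    using x(1) by (auto simp: small_oscillation_def)
  show ?thesis
    unfolding in_closure_of
  proof (intro conjI allI impI xX)
    fix T assume T: "x \<in> T \<and> openin X T"
    then have "openin X (P \<inter> T)" "x \<in> P \<inter> T"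
      using P by auto
    moreover have "0 < e/3"
      using e by simp
    ultimately obtain W where W: "openin X W" "W \<noteq> {}" "W \<subseteq> P \<inter> T"
        "\<And>w. w \<in> W \<Longrightarrow> d (g x) (g w) < e/3"
      using quasicontinuous_mapD [OF g] by metis
    have "W \<subseteq> {y \<in> topspace X. d (f y) (g y) < e}"
    proof
      fix y assume y: "y \<in> W"
      then have yX: "y \<in> topspace X"
        using W(1) openin_subset by blast
      have "d (f y) (g y) \<le> d (f y) (f x) + d (f x) (g x) + d (g x) (g y)"
        using triangle [of "f y" "f x" "g y"] triangle [of "f x" "g x" "g y"] fM gM xX yX by force
      moreover have "d (f y) (f x) < e/3"
        using P y W by blast
      ultimately show "y \<in> {y \<in> topspace X. d (f y) (g y) < e}"
        using yX x(2) W(4) [OF y] by simp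
    qed
    then have "W \<subseteq> X interior_of {y \<in> topspace X. d (f y) (g y) < e}"
      using W(1) by (simp add: interior_of_maximal)
    then show "\<exists>y. y \<in> X interior_of {y \<in> topspace X. d (f y) (g y) < e} \<and> y \<in> T"
      using W by blast
  qed
qed

context Metric_space12
begin

text \<open>Here \<open>M1 - G\<close> is the set of bad points, where \<open>f\<close> oscillates by \<open>e/3\<close> or more, and \<open>D n\<close> are the first of them in
  an enumeration. If \<open>M1\<close> is finite there are no suitable covers, but then a single \<open>g\<close> from \<open>A 0\<close>
  is close to \<open>f\<close> on all of \<open>M1\<close>.\<close>

lemma finite_selection_fixed_accuracy:
  assumes S: "S_fin (K_Omega M1.mtopology) (K_Omega M1.mtopology)"
    and f: "f \<in> quasicontinuous_functions M1.mtopology M2.mtopology"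
    and A: "\<And>n. A n \<subseteq> quasicontinuous_functions M1.mtopology M2.mtopology"
    and fA: "\<And>n. f \<in> Q_p M1.mtopology M2.mtopology closure_of A n" and e: "0 < e"
  obtains K where "\<And>n::nat. finite (K n)" "\<And>n. K n \<subseteq> A n"
    "\<And>F. finite F \<Longrightarrow> F \<subseteq> M1 \<Longrightarrow> \<exists>g\<in>\<Union>n. K n. \<forall>x\<in>F. d2 (f x) (g x) < e"
proof -
  let ?X = "M1.mtopology"
  have approx: "\<exists>g\<in>A n. \<forall>x\<in>F. d2 (f x) (g x) < \<delta>" if "finite F" "F \<subseteq> M1" "0 < \<delta>" for F \<delta> n
    using fA [of n] that unfolding M2.in_closure_of_Q_p [OF A] by simp
  show ?thesis
  proof (cases "finite M1")
    case True
    have "\<exists>g\<in>A n. \<forall>x\<in>M1. d2 (f x) (g x) < e" for n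
      using approx True e by blast
    then obtain g where g: "\<And>n. g n \<in> A n" "\<And>n x. x \<in> M1 \<Longrightarrow> d2 (f x) (g n x) < e"
      by metis
    show ?thesis
      by (rule that [of "\<lambda>n. {g n}"]) (use g in \<open>auto intro!: exI [of _ 0]\<close>)
  next
    case False
    have fq: "quasicontinuous_map ?X M2.mtopology f"
      using f by (simp add: quasicontinuous_functions_def)
    define G where "G = M2.small_oscillation ?X f (e/3)"
    have Gopen: "openin ?X G"
      by (simp add: G_def M2.openin_small_oscillation)
    have "countable (M1 - G)"
      using M1.countable_nowhere_dense_if_S_fin [OF S Gopen]
        M2.dense_small_oscillation [OF fq] e by (simp add: G_def)
    define D where "D = (\<lambda>n. {x \<in> M1 - G. to_nat_on (M1 - G) x \<le> n})"
    have finD: "finite (D n)" for n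
    proof -
      have "inj_on (to_nat_on (M1 - G)) (D n)"
        using inj_on_to_nat_on [OF \<open>countable (M1 - G)\<close>] by (rule inj_on_subset) (auto simp: D_def)
      moreover have "finite (to_nat_on (M1 - G) ` D n)"
        by (rule finite_subset [of _ "{..n}"]) (auto simp: D_def)
      ultimately show ?thesis
        by (rule finite_imageD [rotated])
    qed
    define good where "good = (\<lambda>n U g. (\<forall>x\<in>D n. d2 (f x) (g x) < e) \<and>
        (\<forall>z\<in>?X closure_of U. d2 (f z) (g z) < e \<or> (\<exists>x\<in>M1 - G. d1 x z < inverse (Suc n))))"
    define \<U> where "\<U> = (\<lambda>n. {U. openin ?X U \<and> ?X closure_of U \<noteq> M1 \<and> (\<exists>g\<in>A n. good n U g)})"
    have "\<U> n \<in> K_Omega ?X" for n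
    proof (rule K_OmegaI)
      fix F assume F: "finite F" "F \<subseteq> topspace ?X"
      have FD: "finite (F \<union> D n)" "F \<union> D n \<subseteq> M1" "0 < e/3"
        using F finD e by (auto simp: D_def)
      obtain g where g: "g \<in> A n" "\<And>x. x \<in> F \<union> D n \<Longrightarrow> d2 (f x) (g x) < e/3"
        using approx [OF FD] by blast
      have gq: "quasicontinuous_map ?X M2.mtopology g"
        using g(1) A by (auto simp: quasicontinuous_functions_def)
      let ?I = "?X interior_of {y \<in> topspace ?X. d2 (f y) (g y) < e}"
      \<comment> \<open>Near a bad point nothing is known about \<open>g\<close>, so any open set may be used there; the tolerance covers it.\<close>
      let ?G = "\<lambda>x. if x \<in> G then ?I else M1"
      have G': "openin ?X (?G x) \<and> x \<in> ?X closure_of (?G x)" if x: "x \<in> F" for x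
      proof (cases "x \<in> G")
        case True
        then show ?thesis
          using M2.in_closure_of_interior_close [OF fq gq _ _ e] g(2) x by (simp add: G_def)
      next
        case False
        then show ?thesis
          using x F closure_of_topspace [of ?X] openin_topspace [of ?X] by auto
      qed
      have "F \<subseteq> M1" "0 < inverse (real (Suc n))"
        using F by auto
      then obtain U where U: "openin ?X U" "F \<subseteq> ?X closure_of U" "?X closure_of U \<noteq> M1"
          "\<And>z. z \<in> ?X closure_of U \<Longrightarrow> z \<in> F \<or> (\<exists>x\<in>F. z \<in> ?G x \<and> d1 x z < inverse (Suc n))"
        by (rule M1.nondense_open_with_prescribed_closure [OF False F(1), where G = ?G])
          (erule G', rule that)
      have "d2 (f z) (g z) < e \<or> (\<exists>x\<in>M1 - G. d1 x z < inverse (Suc n))"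
        if z: "z \<in> ?X closure_of U" for z
      proof (cases "z \<in> F")
        case True
        then show ?thesis
          using g(2)[of z] e by auto
      next
        case False
        then obtain x where x: "x \<in> F" "z \<in> ?G x" "d1 x z < inverse (Suc n)"
          using U(4) [OF z] by blast
        show ?thesis
        proof (cases "x \<in> G")
          case True
          then have "z \<in> {y \<in> topspace ?X. d2 (f y) (g y) < e}"
            using x(2) interior_of_subset [of ?X] by auto
          then show ?thesis by simp
        next
          case False
          then show ?thesis
            using x F by auto
        qed
      qed
      moreover have "\<forall>x\<in>D n. d2 (f x) (g x) < e"
        using g(2) e by fastforce
      ultimately have "good n U g"
        unfolding good_def by blast
      then have "U \<in> \<U> n"
        unfolding \<U>_def using U(1,3) g(1) by blast
      then show "\<exists>U\<in>\<U> n. F \<subseteq> ?X closure_of U"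
        using U(2) by blast
    qed (auto simp: \<U>_def)
    then obtain B where B: "\<And>n. finite (B n)" "\<And>n. B n \<subseteq> \<U> n" "(\<Union>n. B n) \<in> K_Omega ?X"
      using S [unfolded S_fin_def, rule_format, of \<U>] by metis
    have "\<forall>n. \<forall>U\<in>B n. \<exists>g\<in>A n. good n U g"
      using B(2) by (auto simp: \<U>_def)
    then obtain g where g: "\<And>n U. U \<in> B n \<Longrightarrow> g n U \<in> A n \<and> good n U (g n U)"
      by metis
    define K where "K = (\<lambda>n. g n ` B n)"
    have "\<exists>h\<in>\<Union>n. K n. \<forall>x\<in>F. d2 (f x) (h x) < e" if F: "finite F" "F \<subseteq> M1" for F
    proof -
      have "\<exists>N. \<forall>n\<ge>N. (x \<notin> G \<longrightarrow> x \<in> D n) \<and>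
          (x \<in> G \<longrightarrow> \<not> (\<exists>y\<in>M1 - G. d1 y x < inverse (Suc n)))" if x: "x \<in> F" for x
      proof (cases "x \<in> G")
        case True
        then obtain r where r: "0 < r" "M1.mball x r \<subseteq> G"
          using Gopen unfolding M1.openin_mtopology by blast
        then obtain N where N: "inverse (Suc N) < r"
          using reals_Archimedean by blast
        have "\<not> (\<exists>y\<in>M1 - G. d1 y x < inverse (Suc n))" if "N \<le> n" for n
        proof -
          have "inverse (real (Suc n)) \<le> inverse (real (Suc N))"
            using that by simp
          then have "d1 x y < r" if "d1 y x < inverse (Suc n)" for y
            using N that M1.commute [of x y] by linarith
          then have "y \<in> G" if "y \<in> M1" "d1 y x < inverse (Suc n)" for y
            using x F(2) that by (intro subsetD [OF r(2)]) auto
          then show ?thesis by blast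
        qed
        then show ?thesis
          using True by (intro exI [of _ N]) simp
      next
        case False
        then show ?thesis
          using x F(2) by (intro exI [of _ "to_nat_on (M1 - G) x"]) (auto simp: D_def)
      qed
      then obtain N where N: "\<And>x n. x \<in> F \<Longrightarrow> N x \<le> n \<Longrightarrow> (x \<notin> G \<longrightarrow> x \<in> D n) \<and>
          (x \<in> G \<longrightarrow> \<not> (\<exists>y\<in>M1 - G. d1 y x < inverse (Suc n)))"
        by metis
      \<comment> \<open>From index \<open>m\<close> on, every bad point of \<open>F\<close> is controlled directly and every other point of \<open>F\<close> is out of
        reach of the tolerance.\<close>
      define m where "m = Max (insert 0 (N ` F))"
      have m: "N x \<le> m" if "x \<in> F" for x
        using F that by (simp add: m_def)
      define C where "C = (\<Union>n<m. B n)"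
      have "finite C"
        using B(1) by (simp add: C_def)
      \<comment> \<open>Adding a point outside the closure of each \<open>U \<in> C\<close> to \<open>F\<close> rules out every set selected before \<open>m\<close>.\<close>
      have "\<forall>U\<in>C. \<exists>p\<in>M1. p \<notin> ?X closure_of U"
        using B(2) closure_of_subset_topspace [of ?X] by (fastforce simp: C_def \<U>_def)
      then obtain p where p: "\<And>U. U \<in> C \<Longrightarrow> p U \<in> M1 \<and> p U \<notin> ?X closure_of U"
        by metis
      have "finite (F \<union> p ` C) \<and> F \<union> p ` C \<subseteq> topspace ?X"
        using F p \<open>finite C\<close> by auto
      then obtain U where U: "U \<in> (\<Union>n. B n)" "F \<union> p ` C \<subseteq> ?X closure_of U"
        using K_OmegaD(3) [OF B(3)] by metis
      then obtain n where n: "U \<in> B n" by blast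
      have "U \<notin> C"
      proof
        assume "U \<in> C"
        then have "p U \<in> ?X closure_of U"
          using U(2) by (intro subsetD [OF U(2)] UnI2 imageI)
        then show False
          using p [OF \<open>U \<in> C\<close>] by simp
      qed
      have "m \<le> n"
      proof (rule ccontr)
        assume "\<not> m \<le> n"
        then have "U \<in> C"
          unfolding C_def using n by (intro UN_I [of n]) simp_all
        with \<open>U \<notin> C\<close> show False ..
      qed
      have "d2 (f x) (g n U x) < e" if x: "x \<in> F" for x
      proof -
        have "N x \<le> n"
          using m [OF x] \<open>m \<le> n\<close> by simp
        then have Nx: "x \<notin> G \<longrightarrow> x \<in> D n" "x \<in> G \<longrightarrow> \<not> (\<exists>y\<in>M1 - G. d1 y x < inverse (Suc n))"
          using N [OF x] by blast+
        have gU: "\<forall>x\<in>D n. d2 (f x) (g n U x) < e"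
          "\<forall>z\<in>?X closure_of U. d2 (f z) (g n U z) < e \<or> (\<exists>x\<in>M1 - G. d1 x z < inverse (Suc n))"
          using g [OF n] unfolding good_def by simp_all
        have "x \<in> ?X closure_of U"
          using x U(2) by blast
        then show ?thesis
          using Nx gU by metis
      qed
      then show ?thesis
        using n by (auto simp: K_def)
    qed
    moreover have "finite (K n)" "K n \<subseteq> A n" for n
      unfolding K_def using B(1) g by (simp_all add: image_subset_iff)
    ultimately show ?thesis
      using that [of K] by metis
  qed
qed

lemma countable_fan_tightness_if_S_fin:
  assumes S: "S_fin (K_Omega M1.mtopology) (K_Omega M1.mtopology)"
  shows "countable_fan_tightness (Q_p M1.mtopology M2.mtopology)"
  unfolding countable_fan_tightness_def countable_fan_tightness_at_def topspace_Q_p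
proof (intro ballI allI impI)
  let ?Q = "quasicontinuous_functions M1.mtopology M2.mtopology"
  fix f and A :: "nat \<Rightarrow> ('a \<Rightarrow> 'b) set"
  assume f: "f \<in> ?Q"
    and A: "\<forall>n. A n \<subseteq> ?Q \<and> f \<in> Q_p M1.mtopology M2.mtopology closure_of A n"
  define accurate where "accurate = (\<lambda>m K. (\<forall>n. finite (K n) \<and> K n \<subseteq> A (prod_encode (m, n))) \<and>
      (\<forall>F. finite F \<and> F \<subseteq> M1 \<longrightarrow> (\<exists>g\<in>\<Union>n. K n. \<forall>x\<in>F. d2 (f x) (g x) < inverse (Suc m))))"
  have "\<exists>K. accurate m K" for m
  proof (rule finite_selection_fixed_accuracy [OF S f, of "\<lambda>n. A (prod_encode (m, n))"])
    show "A (prod_encode (m, n)) \<subseteq> ?Q"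
      "f \<in> Q_p M1.mtopology M2.mtopology closure_of A (prod_encode (m, n))" for n
      using A by simp_all
    show "0 < inverse (real (Suc m))"
      by simp
  next
    fix K
    assume K: "\<And>n. finite (K n)" "\<And>n. K n \<subseteq> A (prod_encode (m, n))"
      "\<And>F. finite F \<Longrightarrow> F \<subseteq> M1 \<Longrightarrow> \<exists>g\<in>\<Union>n. K n. \<forall>x\<in>F. d2 (f x) (g x) < inverse (Suc m)"
    have "accurate m K"
      unfolding accurate_def by (intro conjI allI impI K; elim conjE)
    then show "\<exists>K. accurate m K"
      by (rule exI [of _ K])
  qed
  then obtain L where "\<And>m. accurate m (L m)"
    by metis
  then have L: "finite (L m n)" "L m n \<subseteq> A (prod_encode (m, n))"
      "finite F \<Longrightarrow> F \<subseteq> M1 \<Longrightarrow> \<exists>g\<in>\<Union>n. L m n. \<forall>x\<in>F. d2 (f x) (g x) < inverse (Suc m)" for m n F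
    unfolding accurate_def by simp_all
  define K where "K = (\<lambda>i. case prod_decode i of (m, n) \<Rightarrow> L m n)"
  have K: "finite (K i)" "K i \<subseteq> A i" for i
    using L(1) L(2)[of "fst (prod_decode i)" "snd (prod_decode i)"] by (auto simp: K_def split: prod.splits)
  have LK: "L m n \<subseteq> (\<Union>i. K i)" for m n
    by (rule order_trans [OF _ UN_upper [of "prod_encode (m, n)"]]) (auto simp: K_def)
  have "f \<in> Q_p M1.mtopology M2.mtopology closure_of (\<Union>i. K i)"
  proof (subst M2.in_closure_of_Q_p)
    show "(\<Union>i. K i) \<subseteq> ?Q"
      using K(2) A by blast
    have "\<exists>g\<in>\<Union>i. K i. \<forall>x\<in>F. d2 (f x) (g x) < e" if F: "finite F" "F \<subseteq> M1" and "0 < e" for F e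
    proof -
      obtain m where m: "inverse (Suc m) < e"
        using \<open>0 < e\<close> reals_Archimedean by blast
      obtain g where "g \<in> (\<Union>n. L m n)" and g: "\<forall>x\<in>F. d2 (f x) (g x) < inverse (Suc m)"
        using L(3) [OF F] by blast
      then have "g \<in> (\<Union>i. K i)"
        using LK by blast
      then show ?thesis
        using g m by (intro bexI [of _ g]) force+
    qed
    then show "f \<in> ?Q \<and> (\<forall>F e. finite F \<and> F \<subseteq> topspace M1.mtopology \<and> 0 < e \<longrightarrow>
        (\<exists>g\<in>\<Union>i. K i. \<forall>x\<in>F. d2 (f x) (g x) < e))"
      using f by simp
  qed
  then show "\<exists>K. (\<forall>n. finite (K n) \<and> K n \<subseteq> A n) \<and>
      f \<in> Q_p M1.mtopology M2.mtopology closure_of (\<Union>n. K n)"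
    using K by blast
qed

end

section \<open>The equivalence\<close>

lemma metrizable_countable_fan_tightness_if_S_fin:
  assumes "metrizable_space X" and "S_fin (K_Omega X) (K_Omega X)" and "Metric_space M d"
  shows "countable_fan_tightness (Q_p X (Metric_space.mtopology M d))"
proof -
  obtain N e where N: "Metric_space N e" "X = Metric_space.mtopology N e"
    using assms(1) unfolding metrizable_space_def by blast
  then have "Metric_space12 N e M d"
    using assms(3) by (simp add: Metric_space12_def)
  then show ?thesis
    using Metric_space12.countable_fan_tightness_if_S_fin assms(2) N(2) by metis
qed

theorem theorem6p6:
  fixes X :: "'a topology"
  assumes "metrizable_space X"
    and "\<exists>y y' :: 'b. y \<noteq> y'"
    and "\<exists>y y' :: 'c. y \<noteq> y'"
  defines "cond1 \<equiv> \<forall>(M :: 'b set) d.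
             Metric_space M d \<and> (\<exists>y \<in> M. \<exists>y' \<in> M. y \<noteq> y') \<longrightarrow>
             countable_fan_tightness (Q_p X (Metric_space.mtopology M d))"
    and "cond2 \<equiv> \<exists>(M :: 'c set) d f.
             Metric_space M d \<and> (\<exists>y \<in> M. \<exists>y' \<in> M. y \<noteq> y') \<and>
             f \<in> topspace (Q_p X (Metric_space.mtopology M d)) \<and>
             countable_fan_tightness_at (Q_p X (Metric_space.mtopology M d)) f"
    and "cond3 \<equiv> \<exists>f \<in> topspace (Q_p X euclideanreal).
             countable_fan_tightness_at (Q_p X euclideanreal) f"
    and "cond4 \<equiv> S_fin (K_Omega X) (K_Omega X)"
  shows "(cond1 \<longleftrightarrow> cond2) \<and> (cond2 \<longleftrightarrow> cond3) \<and> (cond3 \<longleftrightarrow> cond4)"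
proof -
  have X: "regular_space X" "t1_space X"
    using assms(1) by (simp_all add: metrizable_imp_regular_space metrizable_imp_t1_space)
  note to_S_fin = Metric_space.S_fin_if_countable_fan_tightness_at [OF _ X]
  note from_S_fin = metrizable_countable_fan_tightness_if_S_fin [OF assms(1)]
  \<comment> \<open>The first condition is applied to, and the second obtained from, a discrete space on the whole
    type, which has two points by assumption.\<close>
  let ?disc = "discrete_metric.dd"
  have "cond4" if cond1
  proof -
    obtain y y' :: 'b where y: "y \<noteq> y'"
      using assms(2) by blast
    let ?Y = "Metric_space.mtopology (UNIV :: 'b set) ?disc"
    have tight: "countable_fan_tightness (Q_p X ?Y)"
      using that y metric_M_dd unfolding cond1_def by blast
    obtain f where f: "f \<in> topspace (Q_p X ?Y)"
      using Q_p_nonempty [of y ?Y X] Metric_space.topspace_mtopology [OF metric_M_dd]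
      by (metis UNIV_I)
    then show ?thesis
      using to_S_fin [OF metric_M_dd UNIV_I UNIV_I y, of f] tight
      unfolding cond4_def countable_fan_tightness_def topspace_Q_p by blast
  qed
  moreover have "cond1" if cond4
    using that from_S_fin unfolding cond1_def cond4_def by blast
  moreover have "cond4" if c2: cond2
  proof -
    obtain M :: "'c set" and d f y y' where Md: "Metric_space M d" "y \<in> M" "y' \<in> M" "y \<noteq> y'"
        and f: "f \<in> topspace (Q_p X (Metric_space.mtopology M d))"
          "countable_fan_tightness_at (Q_p X (Metric_space.mtopology M d)) f"
      using c2 unfolding cond2_def by blast
    show ?thesis
      unfolding cond4_def using to_S_fin [OF Md] f unfolding topspace_Q_p by blast
  qed
  moreover have "cond2" if cond4
  proof -
    obtain y y' :: 'c where y: "y \<noteq> y'"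
      using assms(3) by blast
    let ?Y = "Metric_space.mtopology (UNIV :: 'c set) ?disc"
    obtain f where f: "f \<in> topspace (Q_p X ?Y)"
      using Q_p_nonempty [of y ?Y X] Metric_space.topspace_mtopology [OF metric_M_dd]
      by (metis UNIV_I)
    moreover have "countable_fan_tightness_at (Q_p X ?Y) f"
      using from_S_fin [OF that [unfolded cond4_def] metric_M_dd] f
      unfolding countable_fan_tightness_def by blast
    ultimately show ?thesis
      using y metric_M_dd unfolding cond2_def by blast
  qed
  moreover have "cond4" if c3: cond3
  proof -
    obtain f where "f \<in> topspace (Q_p X euclideanreal)"
        "countable_fan_tightness_at (Q_p X euclideanreal) f"
      using c3 unfolding cond3_def by blast
    then show ?thesis
      using to_S_fin [OF Met_TC.Metric_space_axioms, of "0::real" 1 f]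
      unfolding cond4_def topspace_Q_p by simp
  qed
  moreover have "cond3" if cond4
  proof -
    obtain f where "f \<in> topspace (Q_p X euclideanreal)"
      using Q_p_nonempty [of "0::real" euclideanreal X] by auto
    then show ?thesis
      using from_S_fin [OF that [unfolded cond4_def] Met_TC.Metric_space_axioms [where 'a = real]]
      unfolding cond3_def countable_fan_tightness_def by auto
  qed
  ultimately show ?thesis by blast
qed

end
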